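(* Let $L$ be a lattice of finite length and let $\mathcal{Q}\subseteq Cov(L)$ be a (possibly empty) set of coverings of $L$. The following are equivalent: (a) $\mathcal{Q}$ is closed under subtransposition, i.e. for all $(a,b)\in\mathcal{Q}$ and all intervals $[c,d]$ of $L$ that are transposed to $[a,b]$, it follows that $(c',d')\in\mathcal{Q}$ for all $c',d'\in L$ with $c\le c'\prec d'\le d$. (b) There is a lattice congruence $\theta\in Con(L)$ with $\mathcal{Q}=Cov(\theta)$.
   Context: A lattice $L$ has finite length if the cardinalities of all its chains are bounded by a universal constant. Joins are written $x+y$ and meets $xy$. Write $x\prec y$ if $x<y$ and there is no $z$ with $x<z<y$. For $c<d$ in $L$ the interval is $[c,d]=\{x\in L: c\le x\le d\}$. A covering of $L$ is a two-element interval $[a,b]$, i.e. $a\prec b$; it is denoted $(a,b)$ and viewed as an element of $L\times L$. $Cov(L)$ is the set of all coverings. An interval $[c,d]$ is upper transposed to $[a,b]$ if $a=bc$ and $d=b+c$; it is lower transposed to $[a,b]$ if $c=ad$ and $b=a+d$. Intervals are transposed if one is upper or lower transposed to the other. $Con(L)$ is the lattice of all lattice congruences of $L$ (regarded as subsets of $L\times L$), and for $\theta\in Con(L)$, $Cov(\theta):=\{(a,b)\in Cov(L): (a,b)\in\theta\}$. *)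

theory Defs
  imports Main
begin

text \<open>
  A lattice is a type of class \<open>lattice\<close>: the join \<open>x + y\<close> is \<open>sup x y\<close>, the meet \<open>x y\<close> is
  \<open>inf x y\<close>. An interval \<open>[c, d]\<close> with \<open>c < d\<close> is represented by its endpoints, which it determines.
\<close>

text \<open>Finiteness of the chains is stated explicitly because \<open>card\<close> is \<open>0\<close> on infinite sets.\<close>

definition finite_length :: "'a::order set \<Rightarrow> bool" where
  "finite_length L \<longleftrightarrow>
     (\<exists>N. \<forall>C \<subseteq> L. Complete_Partial_Order.chain (\<le>) C \<longrightarrow> finite C \<and> card C \<le> N)"

definition covered_by :: "'a::order \<Rightarrow> 'a \<Rightarrow> bool" (infix \<open>\<prec>\<close> 50) where
  "x \<prec> y \<longleftrightarrow> x < y \<and> \<not> (\<exists>z. x < z \<and> z < y)"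

definition coverings :: "('a::order \<times> 'a) set" where
  "coverings = {(a, b). a \<prec> b}"

definition upper_transposed :: "'a::lattice \<Rightarrow> 'a \<Rightarrow> 'a \<Rightarrow> 'a \<Rightarrow> bool" where
  \<comment> \<open>\<open>[c, d]\<close> is upper transposed to \<open>[a, b]\<close>\<close>
  "upper_transposed c d a b \<longleftrightarrow> c < d \<and> a < b \<and> a = inf b c \<and> d = sup b c"

definition lower_transposed :: "'a::lattice \<Rightarrow> 'a \<Rightarrow> 'a \<Rightarrow> 'a \<Rightarrow> bool" where
  \<comment> \<open>\<open>[c, d]\<close> is lower transposed to \<open>[a, b]\<close>\<close>
  "lower_transposed c d a b \<longleftrightarrow> c < d \<and> a < b \<and> c = inf a d \<and> b = sup a d"

definition transposed :: "'a::lattice \<Rightarrow> 'a \<Rightarrow> 'a \<Rightarrow> 'a \<Rightarrow> bool" where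
  "transposed c d a b \<longleftrightarrow>
     upper_transposed c d a b \<or> lower_transposed c d a b \<or>
     upper_transposed a b c d \<or> lower_transposed a b c d"

definition subtransposition_closed :: "('a::lattice \<times> 'a) set \<Rightarrow> bool" where
  "subtransposition_closed Q \<longleftrightarrow>
     (\<forall>(a, b) \<in> Q. \<forall>c d. c < d \<and> transposed c d a b \<longrightarrow>
        (\<forall>c' d'. c \<le> c' \<and> c' \<prec> d' \<and> d' \<le> d \<longrightarrow> (c', d') \<in> Q))"

definition Con :: "('a::lattice \<times> 'a) set set" where
  "Con = {\<theta>. equiv UNIV \<theta> \<and>
     (\<forall>a b c d. (a, b) \<in> \<theta> \<and> (c, d) \<in> \<theta> \<longrightarrow>
        (sup a c, sup b d) \<in> \<theta> \<and> (inf a c, inf b d) \<in> \<theta>)}"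

definition Cov :: "('a::order \<times> 'a) set \<Rightarrow> ('a \<times> 'a) set" where
  "Cov \<theta> = {(a, b) \<in> coverings. (a, b) \<in> \<theta>}"

end

theory Submission
  imports Defs
begin

text \<open>
  The coverings of a congruence are closed under subtransposition because an interval transposed
  to \<open>[a, b]\<close> is \<open>[a + c, b + c]\<close> or \<open>[a c, b c]\<close> for some \<open>c\<close> (\<open>Con_transposed\<close>), and because
  congruence classes are convex (\<open>Con_convex\<close>).

  For the converse, the witness is the equivalence relation \<open>(Q \<union> Q\<inverse>)\<^sup>*\<close> generated by \<open>Q\<close>. Joining
  a covering \<open>(a, b)\<close> with \<open>c\<close> either collapses it or turns it into the upper transposed interval
  \<open>[a + c, b + c]\<close>. In the second case every covering inside the new interval is in \<open>Q\<close>, and because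
  chains are finite this interval is bridged by a chain of such coverings. So a \<open>Q\<close>-step is always
  sent to an ascending \<open>Q\<close>-path (\<open>covering_sup_path\<close>), and dually for meets
  (\<open>covering_inf_path\<close>); hence the generated equivalence is a congruence.

  It remains to see that no covering \<open>(a, b)\<close> outside \<open>Q\<close> is added. The clipping map
  \<open>x \<mapsto> (x + a) b\<close> sends every zigzag of \<open>Q\<close>-steps from \<open>a\<close> to \<open>b\<close> to a zigzag of ascending
  \<open>Q\<close>-paths between the same ends, but now inside the two-element interval \<open>[a, b]\<close>. Such a
  zigzag can leave \<open>a\<close> only by the step \<open>(a, b)\<close> itself (\<open>covering_in_generated_equivalence\<close>).
\<close>

section \<open>Chains of coverings\<close>

text \<open>An infinite descending sequence for either relation would be an infinite chain.\<close>

lemma finite_length_wf: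
  assumes "finite_length (UNIV :: 'a::order set)"
  shows finite_length_wf_less: "wf {(x :: 'a, y). x < y}"
    and finite_length_wf_greater: "wf {(x :: 'a, y). y < x}"
proof -
  have no_seq: False
    if mono: "\<And>i j. i < j \<Longrightarrow> f i < f j \<or> (f j :: 'a) < f i"
    for f :: "nat \<Rightarrow> 'a"
  proof -
    have "Complete_Partial_Order.chain (\<le>) (range f)"
      unfolding Complete_Partial_Order.chain_def
    proof clarify
      fix i j
      assume "\<not> f j \<le> f i"
      then show "f i \<le> f j"
        using mono[of i j] mono[of j i] by (cases i j rule: linorder_cases) auto
    qed
    then have "finite (range f)"
      using assms by (auto simp: finite_length_def)
    moreover have "inj f"
      by (rule injI) (metis mono linorder_neqE_nat order.irrefl)
    ultimately show False
      using finite_imageD infinite_UNIV_nat by blast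
  qed
  show "wf {(x :: 'a, y). x < y}"
    unfolding wf_iff_no_infinite_down_chain
  proof
    assume "\<exists>f. \<forall>i. (f (Suc i), f i) \<in> {(x :: 'a, y). x < y}"
    then obtain f :: "nat \<Rightarrow> 'a" where step: "\<And>i. f (Suc i) < f i" by auto
    have "f j < f i" if "i < j" for i j
      using that by (induction rule: less_Suc_induct) (auto intro: step order.strict_trans)
    then show False using no_seq[of f] by simp
  qed
  show "wf {(x :: 'a, y). y < x}"
    unfolding wf_iff_no_infinite_down_chain
  proof
    assume "\<exists>f. \<forall>i. (f (Suc i), f i) \<in> {(x :: 'a, y). y < x}"
    then obtain f :: "nat \<Rightarrow> 'a" where step: "\<And>i. f i < f (Suc i)" by auto
    have "f i < f j" if "i < j" for i j
      using that by (induction rule: less_Suc_induct) (auto intro: step order.strict_trans)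
    then show False using no_seq[of f] by simp
  qed
qed

lemma covering_below:
  fixes a b :: "'a::order"
  assumes "wf {(x :: 'a, y). x < y}" and "a < b"
  obtains z where "a \<prec> z" and "z \<le> b"
proof -
  obtain z where z: "a < z" "z \<le> b"
    and min: "\<And>y. y < z \<Longrightarrow> \<not> (a < y \<and> y \<le> b)"
    using wfE_min[OF assms(1), of b "{z. a < z \<and> z \<le> b}"] assms(2) by auto
  then have "a \<prec> z"
    unfolding covered_by_def by (meson order.strict_implies_order order.trans)
  with z that show thesis by blast
qed

text \<open>
  Climb from \<open>a\<close> to an upper cover inside \<open>[a, b]\<close> and repeat; the climb ends at \<open>b\<close> because the
  converse order is well-founded.
\<close>

lemma path_of_coverings:
  fixes a b :: "'a::order"
  assumes fin: "finite_length (UNIV :: 'a set)"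
    and "a \<le> b"
    and "\<And>c d. a \<le> c \<Longrightarrow> c \<prec> d \<Longrightarrow> d \<le> b \<Longrightarrow> (c, d) \<in> Q"
  shows "(a, b) \<in> Q\<^sup>*"
  using assms(2,3)
proof (induction a rule: wf_induct_rule[OF finite_length_wf_greater[OF fin]])
  case (1 a)
  show ?case
  proof (cases "a = b")
    case False
    with 1 have "a < b" by simp
    then obtain z where z: "a \<prec> z" "z \<le> b"
      using covering_below[OF finite_length_wf_less[OF fin]] by blast
    then have "a < z" by (simp add: covered_by_def)
    have "(a, z) \<in> Q" using "1.prems"(2) z by simp
    moreover have "(z, b) \<in> Q\<^sup>*"
    proof (rule "1.IH")
      show "(z, a) \<in> {(x, y). y < x}" using \<open>a < z\<close> by simp
      show "z \<le> b" by (fact z)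
      show "(c, d) \<in> Q" if "z \<le> c" "c \<prec> d" "d \<le> b" for c d
        using "1.prems"(2) that \<open>a < z\<close> by (meson less_le_trans less_imp_le)
    qed
    ultimately show ?thesis by (rule converse_rtrancl_into_rtrancl)
  qed simp
qed

lemma path_ascends:
  assumes "Q \<subseteq> coverings" and "(a, b) \<in> Q\<^sup>*"
  shows "a \<le> b"
  using assms(2)
proof induction
  case (step y z)
  then have "y < z" using assms(1) by (auto simp: coverings_def covered_by_def)
  with step.IH show ?case by simp
qed simp

lemma path_between_covering:
  assumes "Q \<subseteq> coverings" and "a \<prec> b" and "(a, b) \<in> Q\<^sup>*"
  shows "(a, b) \<in> Q"
  using assms(3)
proof (cases rule: converse_rtranclE)
  case base
  with assms(2) show ?thesis by (simp add: covered_by_def)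
next
  case (step z)
  then have "a < z" using assms(1) by (auto simp: coverings_def covered_by_def)
  moreover have "z \<le> b" using path_ascends[OF assms(1)] step by blast
  ultimately have "z = b"
    using assms(2) by (auto simp: covered_by_def order.order_iff_strict)
  with step show ?thesis by simp
qed

section \<open>Translates of coverings\<close>

text \<open>
  If \<open>b \<le> a + c\<close> fails, then \<open>b (a + c)\<close> lies in \<open>[a, b]\<close> and is not \<open>b\<close>, so it is \<open>a\<close>. This is
  what makes \<open>[a + c, b + c]\<close> upper transposed to \<open>[a, b]\<close>.
\<close>

lemma covering_sup_path:
  fixes Q :: "('a::lattice \<times> 'a) set"
  assumes fin: "finite_length (UNIV :: 'a set)" and Q: "Q \<subseteq> coverings"
    and closed: "subtransposition_closed Q" and ab: "(a, b) \<in> Q"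
  shows "(sup a c, sup b c) \<in> Q\<^sup>*"
proof (cases "b \<le> sup a c")
  case True
  have "a < b" using ab Q by (auto simp: coverings_def covered_by_def)
  then have "sup a c = sup b c"
    using True by (meson antisym le_sup_iff order.refl sup_ge2 sup_mono less_imp_le)
  then show ?thesis by simp
next
  case False
  have cov: "a \<prec> b" using ab Q by (auto simp: coverings_def)
  then have "a < b" by (simp add: covered_by_def)
  then have le: "a \<le> inf b (sup a c)" by (simp add: less_imp_le)
  have "inf b (sup a c) < b"
    using False by (metis inf_le1 inf_le2 order.order_iff_strict)
  with le cov have meet: "a = inf b (sup a c)"
    unfolding covered_by_def by (metis order.order_iff_strict)
  have join: "sup b c = sup b (sup a c)"
    using \<open>a < b\<close> by (simp add: sup_assoc[symmetric] sup_absorb1 less_imp_le)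
  have le': "sup a c \<le> sup b c" using \<open>a < b\<close> by (simp add: le_supI1 less_imp_le)
  have "sup a c < sup b c"
    using le' False by (metis order.order_iff_strict sup_ge1)
  with meet join \<open>a < b\<close> have "transposed (sup a c) (sup b c) a b"
    unfolding transposed_def upper_transposed_def by metis
  with closed ab \<open>sup a c < sup b c\<close> show ?thesis
    unfolding subtransposition_closed_def
    by (intro path_of_coverings[OF fin le']) blast
qed

text \<open>
  Dually, if \<open>b c \<le> a\<close> fails, then \<open>a + b c = b\<close>, and \<open>[a c, b c]\<close> is lower transposed to \<open>[a, b]\<close>.
\<close>

lemma covering_inf_path:
  fixes Q :: "('a::lattice \<times> 'a) set"
  assumes fin: "finite_length (UNIV :: 'a set)" and Q: "Q \<subseteq> coverings"
    and closed: "subtransposition_closed Q" and ab: "(a, b) \<in> Q"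
  shows "(inf a c, inf b c) \<in> Q\<^sup>*"
proof (cases "inf b c \<le> a")
  case True
  have "a < b" using ab Q by (auto simp: coverings_def covered_by_def)
  then have "inf a c = inf b c"
    using True by (meson antisym le_inf_iff order.refl inf_le2 inf_mono less_imp_le)
  then show ?thesis by simp
next
  case False
  have cov: "a \<prec> b" using ab Q by (auto simp: coverings_def)
  then have "a < b" by (simp add: covered_by_def)
  then have le: "sup a (inf b c) \<le> b" by (simp add: less_imp_le)
  have "a < sup a (inf b c)"
    using False by (metis order.order_iff_strict sup_ge1 sup_ge2)
  with le cov have join: "b = sup a (inf b c)"
    unfolding covered_by_def by (metis order.order_iff_strict)
  have meet: "inf a c = inf a (inf b c)"
    using \<open>a < b\<close> by (metis inf_assoc inf_absorb1 less_imp_le)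
  have le': "inf a c \<le> inf b c" using \<open>a < b\<close> by (simp add: le_infI1 less_imp_le)
  have "inf a c < inf b c"
    using le' False by (metis order.order_iff_strict inf_le1)
  with meet join \<open>a < b\<close> have "transposed (inf a c) (inf b c) a b"
    unfolding transposed_def lower_transposed_def by metis
  with closed ab \<open>inf a c < inf b c\<close> show ?thesis
    unfolding subtransposition_closed_def
    by (intro path_of_coverings[OF fin le']) blast
qed

section \<open>The generated equivalence\<close>

lemma generated_equivalence_image:
  assumes "\<And>a b. (a, b) \<in> Q \<Longrightarrow> (f a, f b) \<in> Q\<^sup>*"
    and "(x, y) \<in> (Q \<union> Q\<inverse>)\<^sup>*"
  shows "(f x, f y) \<in> (Q \<union> Q\<inverse>)\<^sup>*"
  using assms(2)
proof induction
  case (step y z)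
  have "(f y, f z) \<in> Q\<^sup>* \<or> (f y, f z) \<in> (Q\<inverse>)\<^sup>*"
    using step.hyps(2) assms(1) by (auto simp: rtrancl_converse)
  then have "(f y, f z) \<in> (Q \<union> Q\<inverse>)\<^sup>*"
    using rtrancl_mono[of Q "Q \<union> Q\<inverse>"] rtrancl_mono[of "Q\<inverse>" "Q \<union> Q\<inverse>"] by blast
  with step.IH show ?case by (rule rtrancl_trans)
qed simp

lemma generated_equivalence_is_congruence:
  fixes Q :: "('a::lattice \<times> 'a) set"
  assumes "finite_length (UNIV :: 'a set)" and "Q \<subseteq> coverings"
    and "subtransposition_closed Q"
  shows "(Q \<union> Q\<inverse>)\<^sup>* \<in> Con"
proof -
  let ?\<theta> = "(Q \<union> Q\<inverse>)\<^sup>*"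
  have "equiv UNIV ?\<theta>"
    by (intro equivI refl_rtrancl sym_rtrancl trans_rtrancl) (auto intro: symI)
  moreover have "(sup a c, sup b d) \<in> ?\<theta>"
    if "(a, b) \<in> ?\<theta>" "(c, d) \<in> ?\<theta>" for a b c d
  proof -
    have "(sup x z, sup y z) \<in> ?\<theta>" if "(x, y) \<in> ?\<theta>" for x y z
      using covering_sup_path[OF assms] that by (rule generated_equivalence_image)
    from this[of a b c] this[of c d b] that show ?thesis
      by (simp add: sup_commute[of b])
  qed
  moreover have "(inf a c, inf b d) \<in> ?\<theta>"
    if "(a, b) \<in> ?\<theta>" "(c, d) \<in> ?\<theta>" for a b c d
  proof -
    have "(inf x z, inf y z) \<in> ?\<theta>" if "(x, y) \<in> ?\<theta>" for x y z
      using covering_inf_path[OF assms] that by (rule generated_equivalence_image)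
    from this[of a b c] this[of c d b] that show ?thesis
      by (simp add: inf_commute[of b])
  qed
  ultimately show ?thesis by (simp add: Con_def)
qed

text \<open>
  Suppose \<open>(a, b) \<notin> Q\<close> and follow the value of the clipping map along a zigzag of \<open>Q\<close>-steps from
  \<open>a\<close>. A forward step cannot move it from \<open>a\<close> to \<open>b\<close>, as a \<open>Q\<close>-path from \<open>a\<close> to \<open>b\<close> would be the
  single step \<open>(a, b)\<close>; a backward step cannot, as \<open>Q\<close>-paths ascend. So the value stays \<open>a\<close>, and
  the zigzag never reaches \<open>b\<close>, which the map fixes.
\<close>

lemma covering_in_generated_equivalence:
  fixes Q :: "('a::lattice \<times> 'a) set"
  assumes asms: "finite_length (UNIV :: 'a set)" "Q \<subseteq> coverings"
    "subtransposition_closed Q"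
    and cov: "a \<prec> b" and ab: "(a, b) \<in> (Q \<union> Q\<inverse>)\<^sup>*"
  shows "(a, b) \<in> Q"
proof (rule ccontr)
  assume notin: "(a, b) \<notin> Q"
  let ?f = "\<lambda>x. inf (sup x a) b"
  have "a < b" using cov by (simp add: covered_by_def)
  have clip: "?f x = a \<or> ?f x = b" for x
  proof -
    have "a \<le> ?f x" "?f x \<le> b" using \<open>a < b\<close> by (simp_all add: less_imp_le)
    with cov show ?thesis unfolding covered_by_def by (metis order.order_iff_strict)
  qed
  have path: "(?f x, ?f y) \<in> Q\<^sup>*" if "(x, y) \<in> Q" for x y
    using covering_sup_path[OF asms that, of a]
  proof induction
    case (step u v)
    with covering_inf_path[OF asms, of u v b] show ?case
      by (meson rtrancl_trans)
  qed simp
  have "?f w = a" if "(a, w) \<in> (Q \<union> Q\<inverse>)\<^sup>*" for w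
    using that
  proof induction
    case base
    show ?case using \<open>a < b\<close> by (simp add: inf_absorb1 less_imp_le)
  next
    case (step y z)
    from step.hyps(2) consider "(y, z) \<in> Q" | "(z, y) \<in> Q" by blast
    then show ?case
    proof cases
      case 1
      then have "(a, ?f z) \<in> Q\<^sup>*" using path step.IH by metis
      then show ?thesis
        using clip[of z] path_between_covering[OF asms(2) cov] notin by metis
    next
      case 2
      then have "(?f z, a) \<in> Q\<^sup>*" using path step.IH by metis
      then have "?f z \<le> a" by (rule path_ascends[OF asms(2)])
      then show ?thesis using clip[of z] \<open>a < b\<close> by auto
    qed
  qed
  with ab have "?f b = a" by blast
  moreover have "?f b = b" by (simp add: inf_absorb2)
  ultimately show False using \<open>a < b\<close> by simp
qed

section \<open>Coverings of a congruence\<close>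

text \<open>
  By absorption, the four cases of transposition reduce to two: \<open>(c, d)\<close> arises from \<open>(a, b)\<close> by
  joining both entries with \<open>c\<close> or by meeting both with \<open>d\<close>.
\<close>

lemma Con_transposed:
  assumes "\<theta> \<in> Con" and "(a, b) \<in> \<theta>" and "transposed c d a b"
  shows "(c, d) \<in> \<theta>"
proof -
  have refl: "(x, x) \<in> \<theta>" for x
    using assms(1) by (auto simp: Con_def equiv_def refl_on_def)
  have "(sup a x, sup b x) \<in> \<theta>" "(inf a x, inf b x) \<in> \<theta>" for x
    using assms(1,2) refl[of x] by (auto simp: Con_def)
  moreover have "(c = sup a c \<and> d = sup b c) \<or> (c = inf a d \<and> d = inf b d)"
    using assms(3)
    unfolding transposed_def upper_transposed_def lower_transposed_def
    by (metis inf_commute inf_sup_absorb sup_commute sup_inf_absorb)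
  ultimately show ?thesis by metis
qed

text \<open>Meeting \<open>(c, d)\<close> with \<open>d'\<close> gives \<open>(c, d')\<close>, and joining that with \<open>c'\<close> gives \<open>(c', d')\<close>.\<close>

lemma Con_convex:
  assumes "\<theta> \<in> Con" and "(c, d) \<in> \<theta>" and "c \<le> c'" "c' \<le> d'" "d' \<le> d"
  shows "(c', d') \<in> \<theta>"
proof -
  have refl: "(x, x) \<in> \<theta>" for x
    using assms(1) by (auto simp: Con_def equiv_def refl_on_def)
  have "(inf c d', inf d d') \<in> \<theta>"
    using assms(1,2) refl[of d'] by (auto simp: Con_def)
  then have "(c, d') \<in> \<theta>"
    using assms(3-5) by (simp add: inf_absorb1 inf_absorb2)
  then have "(sup c c', sup d' c') \<in> \<theta>"
    using assms(1) refl[of c'] by (auto simp: Con_def)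
  then show ?thesis
    using assms(3-5) by (simp add: sup_absorb1 sup_absorb2)
qed

lemma Cov_subtransposition_closed:
  fixes \<theta> :: "('a::lattice \<times> 'a) set"
  assumes "\<theta> \<in> Con"
  shows "subtransposition_closed (Cov \<theta>)"
  unfolding subtransposition_closed_def
proof clarify
  fix a b c d c' d' :: 'a
  assume ab: "(a, b) \<in> Cov \<theta>" and "transposed c d a b"
    and "c \<le> c'" "c' \<prec> d'" "d' \<le> d"
  from ab have "(a, b) \<in> \<theta>" by (simp add: Cov_def)
  then have "(c, d) \<in> \<theta>"
    using \<open>transposed c d a b\<close> by (rule Con_transposed[OF assms])
  moreover have "c' \<le> d'"
    using \<open>c' \<prec> d'\<close> by (simp add: covered_by_def less_imp_le)
  ultimately have "(c', d') \<in> \<theta>"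
    using Con_convex[OF assms] \<open>c \<le> c'\<close> \<open>d' \<le> d\<close> by metis
  with \<open>c' \<prec> d'\<close> show "(c', d') \<in> Cov \<theta>"
    by (simp add: Cov_def coverings_def)
qed

section \<open>The equivalence\<close>

theorem lemma3p1:
  fixes Q :: "('a::lattice \<times> 'a) set"
  assumes "finite_length (UNIV :: 'a set)"
    and "Q \<subseteq> coverings"
  shows "subtransposition_closed Q \<longleftrightarrow> (\<exists>\<theta> \<in> Con. Q = Cov \<theta>)"
proof
  assume closed: "subtransposition_closed Q"
  have "Q = Cov ((Q \<union> Q\<inverse>)\<^sup>*)"
    using assms(2) covering_in_generated_equivalence[OF assms closed]
    by (auto simp: Cov_def coverings_def)
  with generated_equivalence_is_congruence[OF assms closed]
  show "\<exists>\<theta> \<in> Con. Q = Cov \<theta>" by blast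
next
  assume "\<exists>\<theta> \<in> Con. Q = Cov \<theta>"
  then show "subtransposition_closed Q" using Cov_subtransposition_closed by blast
qed

end
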